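(* Let $m\ge 1$ and $b\in[-1,1]^m$, and let $q^*$ and $q_*$ be the supervertex and the subvertex of $P(b)$. For any $u\in (U_{\ell\text{-pos}})^+$ we have $\langle u,q_*\rangle\ge 0$ and $$\max\{E_x(u): x\in P(b)\}=E_{q^*}(u)=\langle u,q^*\rangle,$$ $$\min\{E_x(u): x\in P(b)\}\ \ge\ \langle u,q_*\rangle .$$ If $\sum_{i=1}^m b(i)\le 2-m$, then $q_*\in P(b)$, the last inequality is an equality, and $\langle u,q_*\rangle=E_{q_*}(u)$.
   Context: Fix an integer $m\ge1$. $\mathcal L$ is the set of all functions $\lambda:\{1,\dots,m\}\to\{0,1\}$, with the convention $\lambda(0)=0$. $\mathbb R^{\mathcal L}$ is the space of functions $\mathcal L\to\mathbb R$ with standard basis $\{e_\lambda\}$ and standard inner product $\langle x,y\rangle=\sum_\lambda x(\lambda)y(\lambda)$. For $0\le i\le m$ let $\ell_i\in\mathbb R^{\mathcal L}$, $\ell_i(\lambda)=(-1)^{\lambda(i)}$ (so $\ell_0$ is constant $1$). For $b\in\mathbb R^m$, $P(b)=\{x\in\mathbb R^{\mathcal L}: x(\lambda)\ge 0 \text{ for all }\lambda,\ \langle \ell_0,x\rangle=1,\ \langle \ell_i,x\rangle=b(i)\text{ for }1\le i\le m\}$; its elements are probability density functions on $\mathcal L$. For such $x$ and $f\in\mathbb R^{\mathcal L}$, $E_x(f)=\langle f,x\rangle$ is the expectation. Truncation: for $t\in\mathbb R$, $t^+=\max\{t,0\}$; for $v\in\mathbb R^{\mathcal L}$, $v^+(\lambda)=v(\lambda)^+$.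 $U_{\ell\text{-pos}}$ is the set of vectors $\sum_{i=0}^m a_i\ell_i$ with $a_1,\dots,a_m>0$ and $a_0\in\mathbb R$ arbitrary. $(U_{\ell\text{-pos}})^+=\{\sum_{i=1}^k u_i^+ : u_i\in U_{\ell\text{-pos}},\ k\ge 0\}$. Supervertex $q^*$ (for $b\in[-1,1]^m$): put $b(0)=1$, $b(m+1)=-1$. If $b(1)\ge\dots\ge b(m)$, set $b'(i)=\frac{b(i)-b(i+1)}2$ for $0\le i\le m$, let $\mu_i\in\mathcal L$ be $\mu_i(k)=0$ if $k\le i$ and $\mu_i(k)=1$ if $k\ge i+1$, and let $q^*=\sum_{i=0}^m b'(i)e_{\mu_i}$. For general $b$, choose a permutation $\sigma$ of $\{1,\dots,m\}$ with $b\circ\sigma^{-1}$ decreasing; $q^*$ is the vector for which $\lambda\mapsto q^*(\lambda\circ\sigma)$ is the supervertex of $P(b\circ\sigma^{-1})$ (this does not depend on the choice of $\sigma$). Subvertex $q_*$ (for $b\in[-1,1]^m$): $\nu_i\in\mathcal L$, $0\le i\le m$, is $\nu_i(j)=1-\delta_{ij}$ for $1\le j\le m$; $b''(i)=\frac{b(i)+1}{2}$ for $1\le i\le m$, $b''(0)=1-\sum_{i=1}^m b''(i)$; and $q_*=\sum_{i=0}^m b''(i)e_{\nu_i}\in\mathbb R^{\mathcal L}$ (in general $q_*$ need not lie in $P(b)$). *)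

theory Defs
  imports Complex_Main "HOL-Combinatorics.Permutations"
begin

text \<open>
  The integer \<open>m\<close> is an explicit parameter.  A function \<open>{1,\<dots>,m} \<rightarrow> {0,1}\<close> is represented by
  its extension by \<open>0\<close> to all of \<open>nat\<close>, which includes the convention \<open>\<lambda>(0) = 0\<close>.  Likewise a
  vector of \<open>\<real>\<^sup>L\<close> is represented by its extension by \<open>0\<close> outside \<open>label_set m\<close>.
\<close>

type_synonym label = "nat \<Rightarrow> nat"

definition label_set :: "nat \<Rightarrow> label set" where
  "label_set m = {l. (\<forall>i\<in>{1..m}. l i \<in> {0, 1}) \<and> (\<forall>i. i \<notin> {1..m} \<longrightarrow> l i = 0)}"

definition vec_space :: "nat \<Rightarrow> (label \<Rightarrow> real) set" where
  "vec_space m = {x. \<forall>l. l \<notin> label_set m \<longrightarrow> x l = 0}"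

definition basis_vec :: "label \<Rightarrow> label \<Rightarrow> real" where
  "basis_vec l = (\<lambda>k. if k = l then 1 else 0)"

definition iprod :: "nat \<Rightarrow> (label \<Rightarrow> real) \<Rightarrow> (label \<Rightarrow> real) \<Rightarrow> real" where
  "iprod m x y = (\<Sum>l\<in>label_set m. x l * y l)"

definition ell :: "nat \<Rightarrow> nat \<Rightarrow> label \<Rightarrow> real" where
  "ell m i = (\<lambda>l. if l \<in> label_set m then (- 1) ^ l i else 0)"

text \<open>A point \<open>b \<in> \<real>\<^sup>m\<close> is a function on \<open>nat\<close> of which only the values on \<open>{1..m}\<close> are used.\<close>

definition polytope_P :: "nat \<Rightarrow> (nat \<Rightarrow> real) \<Rightarrow> (label \<Rightarrow> real) set" where
  "polytope_P m b =
     {x \<in> vec_space m. (\<forall>l\<in>label_set m. 0 \<le> x l) \<and> iprod m (ell m 0) x = 1 \<and>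
        (\<forall>i\<in>{1..m}. iprod m (ell m i) x = b i)}"

definition expect :: "nat \<Rightarrow> (label \<Rightarrow> real) \<Rightarrow> (label \<Rightarrow> real) \<Rightarrow> real" where
  "expect m x f = iprod m f x"

definition trunc_vec :: "(label \<Rightarrow> real) \<Rightarrow> label \<Rightarrow> real" where
  "trunc_vec v = (\<lambda>l. max (v l) 0)"

definition U_lpos :: "nat \<Rightarrow> (label \<Rightarrow> real) set" where
  "U_lpos m = {(\<lambda>l. \<Sum>i\<in>{0..m}. a i * ell m i l) | a. \<forall>i\<in>{1..m}. 0 < a i}"

definition U_lpos_plus :: "nat \<Rightarrow> (label \<Rightarrow> real) set" where
  "U_lpos_plus m =
     {(\<lambda>l. \<Sum>i\<in>{1..k}. trunc_vec (u i) l) | (k::nat) u. \<forall>i\<in>{1..k}. u i \<in> U_lpos m}"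

definition b_ext :: "nat \<Rightarrow> (nat \<Rightarrow> real) \<Rightarrow> nat \<Rightarrow> real" where
  "b_ext m b i = (if i = 0 then 1 else if i = m + 1 then - 1 else b i)"

definition b_prime :: "nat \<Rightarrow> (nat \<Rightarrow> real) \<Rightarrow> nat \<Rightarrow> real" where
  "b_prime m b i = (b_ext m b i - b_ext m b (i + 1)) / 2"

definition mu_label :: "nat \<Rightarrow> nat \<Rightarrow> label" where
  "mu_label m i = (\<lambda>k. if i + 1 \<le> k \<and> k \<le> m then 1 else 0)"

definition supervertex_sorted :: "nat \<Rightarrow> (nat \<Rightarrow> real) \<Rightarrow> label \<Rightarrow> real" where
  "supervertex_sorted m b = (\<lambda>l. \<Sum>i\<in>{0..m}. b_prime m b i * basis_vec (mu_label m i) l)"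

definition sorting_perm :: "nat \<Rightarrow> (nat \<Rightarrow> real) \<Rightarrow> (nat \<Rightarrow> nat) \<Rightarrow> bool" where
  "sorting_perm m b \<sigma> \<longleftrightarrow> \<sigma> permutes {1..m} \<and> antimono_on {1..m} (b \<circ> inv \<sigma>)"

definition is_supervertex :: "nat \<Rightarrow> (nat \<Rightarrow> real) \<Rightarrow> (label \<Rightarrow> real) \<Rightarrow> bool" where
  "is_supervertex m b q \<longleftrightarrow>
     q \<in> vec_space m \<and>
     (\<exists>\<sigma>. sorting_perm m b \<sigma> \<and>
        (\<forall>l\<in>label_set m. q (l \<circ> \<sigma>) = supervertex_sorted m (b \<circ> inv \<sigma>) l))"

text \<open>Well defined by lemma \<open>ex1_supervertex\<close> below.\<close>

definition supervertex :: "nat \<Rightarrow> (nat \<Rightarrow> real) \<Rightarrow> label \<Rightarrow> real" where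
  "supervertex m b = (THE q. is_supervertex m b q)"

definition nu_label :: "nat \<Rightarrow> nat \<Rightarrow> label" where
  "nu_label m i = (\<lambda>j. if j \<in> {1..m} \<and> j \<noteq> i then 1 else 0)"

definition b_dprime :: "nat \<Rightarrow> (nat \<Rightarrow> real) \<Rightarrow> nat \<Rightarrow> real" where
  "b_dprime m b i =
     (if i = 0 then 1 - (\<Sum>j\<in>{1..m}. (b j + 1) / 2) else (b i + 1) / 2)"

definition subvertex :: "nat \<Rightarrow> (nat \<Rightarrow> real) \<Rightarrow> label \<Rightarrow> real" where
  "subvertex m b = (\<lambda>l. \<Sum>i\<in>{0..m}. b_dprime m b i * basis_vec (nu_label m i) l)"

text \<open>The library's \<open>Max\<close> and \<open>Min\<close> are meaningful for finite sets only.\<close>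

definition is_maximum :: "real set \<Rightarrow> real \<Rightarrow> bool" where
  "is_maximum S M \<longleftrightarrow> M \<in> S \<and> (\<forall>y\<in>S. y \<le> M)"

definition is_minimum :: "real set \<Rightarrow> real \<Rightarrow> bool" where
  "is_minimum S M \<longleftrightarrow> M \<in> S \<and> (\<forall>y\<in>S. M \<le> y)"


lemma sorting_perm_exists: "\<exists>\<sigma>. sorting_perm m b \<sigma>"
proof -
  define R where "R k = {j\<in>{1..m}. b j > b k \<or> (b j = b k \<and> j \<le> k)}" for k
  define \<sigma> where "\<sigma> k = (if k \<in> {1..m} then card (R k) else k)" for k
  have fin: "finite (R k)" for k by (simp add: R_def)
  have lt: "\<sigma> j < \<sigma> k"
    if "j \<in> {1..m}" "k \<in> {1..m}" "b j > b k \<or> (b j = b k \<and> j < k)" for j k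
  proof -
    have "R j \<subseteq> R k" using that by (auto simp: R_def)
    moreover have "k \<in> R k" "k \<notin> R j" using that by (auto simp: R_def)
    ultimately have "R j \<subset> R k" by blast
    then show ?thesis using that fin psubset_card_mono by (auto simp: \<sigma>_def)
  qed
  have inj: "inj_on \<sigma> {1..m}"
  proof (rule inj_onI)
    fix j k assume *: "j \<in> {1..m}" "k \<in> {1..m}" "\<sigma> j = \<sigma> k"
    show "j = k"
    proof (rule ccontr)
      assume "j \<noteq> k"
      then have "(b j > b k \<or> (b j = b k \<and> j < k)) \<or> (b k > b j \<or> (b k = b j \<and> k < j))"
        by linarith
      then show False using lt[of j k] lt[of k j] * by auto
    qed
  qed
  have "\<sigma> ` {1..m} \<subseteq> {1..m}"
  proof
    fix x assume "x \<in> \<sigma> ` {1..m}"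
    then obtain k where k: "k \<in> {1..m}" "x = card (R k)" by (auto simp: \<sigma>_def)
    have "k \<in> R k" using k by (auto simp: R_def)
    then have "card (R k) > 0" using fin card_gt_0_iff by blast
    moreover have "card (R k) \<le> card {1..m}" by (rule card_mono) (auto simp: R_def)
    ultimately show "x \<in> {1..m}" using k by simp
  qed
  then have "bij_betw \<sigma> {1..m} {1..m}"
    using inj by (simp add: bij_betw_def endo_inj_surj)
  then have perm: "\<sigma> permutes {1..m}"
    by (rule bij_imp_permutes) (simp only: \<sigma>_def if_False)
  have "antimono_on {1..m} (b \<circ> inv \<sigma>)"
  proof (rule monotone_onI)
    fix i j :: nat assume ij: "i \<in> {1..m}" "j \<in> {1..m}" "i \<le> j"
    have in_m: "inv \<sigma> i \<in> {1..m}" "inv \<sigma> j \<in> {1..m}"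
      using permutes_in_image[OF permutes_inv[OF perm]] ij by blast+
    have eq: "\<sigma> (inv \<sigma> i) = i" "\<sigma> (inv \<sigma> j) = j"
      using permutes_inverses[OF perm] by auto
    show "(b \<circ> inv \<sigma>) j \<le> (b \<circ> inv \<sigma>) i"
    proof (rule ccontr)
      assume "\<not> ?thesis"
      then have "\<sigma> (inv \<sigma> j) < \<sigma> (inv \<sigma> i)" using lt in_m by auto
      then show False using eq ij by simp
    qed
  qed
  then show ?thesis using perm by (auto simp: sorting_perm_def)
qed

lemma sorting_perm_values_le:
  assumes s: "sorting_perm m b \<sigma>" and t: "sorting_perm m b \<tau>" and i: "i \<in> {1..m}"
  shows "b (inv \<tau> i) \<le> b (inv \<sigma> i)"
proof (rule ccontr)
  assume "\<not> ?thesis"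
  then have less: "b (inv \<sigma> i) < b (inv \<tau> i)" by simp
  let ?K = "{k\<in>{1..m}. b (inv \<sigma> i) < b k}"
  have ps: "\<sigma> permutes {1..m}" and pt: "\<tau> permutes {1..m}"
    and as: "antimono_on {1..m} (b \<circ> inv \<sigma>)" and at: "antimono_on {1..m} (b \<circ> inv \<tau>)"
    using s t by (auto simp: sorting_perm_def)
  have "\<sigma> ` ?K \<subseteq> {1..<i}"
  proof
    fix x assume "x \<in> \<sigma> ` ?K"
    then obtain k where k: "k \<in> {1..m}" "b (inv \<sigma> i) < b k" "x = \<sigma> k" by auto
    have x: "x \<in> {1..m}" using permutes_in_image[OF ps] k by blast
    have "\<not> i \<le> x"
    proof
      assume "i \<le> x"
      then have "(b \<circ> inv \<sigma>) x \<le> (b \<circ> inv \<sigma>) i" using monotone_onD[OF as i x] by blast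
      then show False using k permutes_inverses[OF ps] by auto
    qed
    then show "x \<in> {1..<i}" using x by auto
  qed
  then have "card (\<sigma> ` ?K) \<le> card {1..<i}" by (rule card_mono[rotated]) simp
  moreover have "card (\<sigma> ` ?K) = card ?K"
    by (rule card_image) (meson inj_on_subset permutes_inj ps subset_UNIV)
  ultimately have 1: "card ?K \<le> i - 1" by simp
  have "inv \<tau> ` {1..i} \<subseteq> ?K"
  proof
    fix x assume "x \<in> inv \<tau> ` {1..i}"
    then obtain j where j: "j \<in> {1..i}" "x = inv \<tau> j" by auto
    then have jm: "j \<in> {1..m}" using i by auto
    then have "x \<in> {1..m}" using permutes_in_image[OF permutes_inv[OF pt]] j by blast
    moreover have "(b \<circ> inv \<tau>) i \<le> (b \<circ> inv \<tau>) j"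
      using monotone_onD[OF at jm i] j by simp
    ultimately show "x \<in> ?K" using less j by auto
  qed
  then have "card (inv \<tau> ` {1..i}) \<le> card ?K" by (rule card_mono[rotated]) simp
  moreover have "card (inv \<tau> ` {1..i}) = i"
    by (subst card_image) (auto intro: inj_on_subset[OF permutes_inj[OF permutes_inv[OF pt]]])
  ultimately show False using 1 i by auto
qed

lemma sorting_perm_values:
  assumes "sorting_perm m b \<sigma>" "sorting_perm m b \<tau>" "i \<in> {1..m}"
  shows "b (inv \<sigma> i) = b (inv \<tau> i)"
  using sorting_perm_values_le assms by (meson order_antisym)

lemma label_set_comp_iff:
  assumes "p permutes {1..m}"
  shows "l \<circ> p \<in> label_set m \<longleftrightarrow> l \<in> label_set m"
proof -
  have *: "l \<circ> r \<in> label_set m" if "l \<in> label_set m" "r permutes {1..m}" for l r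
    using that permutes_in_image[OF that(2)] by (auto simp: label_set_def)
  have "(l \<circ> p) \<circ> inv p = l" using permutes_inv_o[OF assms] by (simp add: comp_assoc)
  then show ?thesis using *[of l p] *[of "l \<circ> p" "inv p"] assms permutes_inv by metis
qed

lemma mu_label_in: "mu_label m i \<in> label_set m"
  by (auto simp: mu_label_def label_set_def)

lemma supervertex_sorted_outside:
  "l \<notin> label_set m \<Longrightarrow> supervertex_sorted m b l = 0"
  unfolding supervertex_sorted_def basis_vec_def using mu_label_in by (auto intro!: sum.neutral)

lemma mu_label_comp_eq:
  assumes s: "sorting_perm m b \<sigma>" and t: "sorting_perm m b \<tau>"
    and i: "i \<le> m" and ne: "b_prime m (b \<circ> inv \<sigma>) i \<noteq> 0"
  shows "mu_label m i \<circ> \<sigma> = mu_label m i \<circ> \<tau>"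
proof -
  have key: "(mu_label m i \<circ> \<rho>) k =
      (if k \<in> {1..m} \<and> (i = 0 \<or> i < m \<and> b k \<le> b (inv \<sigma> (i + 1))) then 1 else 0)"
    if r: "sorting_perm m b \<rho>" for \<rho> k
  proof -
    have pr: "\<rho> permutes {1..m}" and ar: "antimono_on {1..m} (b \<circ> inv \<rho>)"
      using r by (auto simp: sorting_perm_def)
    have rk: "\<rho> k \<in> {1..m} \<longleftrightarrow> k \<in> {1..m}" using permutes_in_image[OF pr] by blast
    have bk: "b (inv \<rho> (\<rho> k)) = b k" using permutes_inverses[OF pr] by simp
    show ?thesis
    proof (cases "k \<in> {1..m} \<and> i \<noteq> 0 \<and> i < m")
      case False
      then show ?thesis using rk i by (auto simp: mu_label_def)
    next
      case True
      then have im: "i \<in> {1..m}" "i + 1 \<in> {1..m}" by auto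
      have km: "\<rho> k \<in> {1..m}" using rk True by blast
      have ge: "b (inv \<sigma> (i + 1)) = b (inv \<rho> (i + 1))" "b (inv \<sigma> i) = b (inv \<rho> i)"
        using sorting_perm_values[OF s r] im by blast+
      have "b (inv \<rho> (i + 1)) \<le> b (inv \<rho> i)" using monotone_onD[OF ar im] by simp
      moreover have "b (inv \<rho> i) \<noteq> b (inv \<rho> (i + 1))"
        using ne True ge by (simp add: b_prime_def b_ext_def)
      ultimately have less: "b (inv \<rho> (i + 1)) < b (inv \<rho> i)" by simp
      have "i + 1 \<le> \<rho> k \<longleftrightarrow> b k \<le> b (inv \<rho> (i + 1))"
      proof
        assume "i + 1 \<le> \<rho> k"
        then show "b k \<le> b (inv \<rho> (i + 1))"
          using monotone_onD[OF ar im(2) km] bk by simp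
      next
        assume le: "b k \<le> b (inv \<rho> (i + 1))"
        show "i + 1 \<le> \<rho> k"
        proof (rule ccontr)
          assume "\<not> ?thesis"
          then have "b (inv \<rho> i) \<le> b k"
            using monotone_onD[OF ar km im(1)] bk by simp
          then show False using le less by simp
        qed
      qed
      then show ?thesis using True km ge by (simp add: mu_label_def)
    qed
  qed
  show ?thesis using key[OF s] key[OF t] by (intro ext) simp
qed

lemma supervertex_sorted_indep:
  assumes s: "sorting_perm m b \<sigma>" and t: "sorting_perm m b \<tau>"
  shows "supervertex_sorted m (b \<circ> inv \<sigma>) (l \<circ> inv \<sigma>) =
         supervertex_sorted m (b \<circ> inv \<tau>) (l \<circ> inv \<tau>)"
proof -
  have eq: "l \<circ> inv \<rho> = mu \<longleftrightarrow> l = mu \<circ> \<rho>" if "sorting_perm m b \<rho>" for \<rho> and mu :: label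
  proof -
    have "\<rho> permutes {1..m}" using that by (simp add: sorting_perm_def)
    from permutes_inv_o[OF this] show ?thesis by (metis comp_assoc comp_id)
  qed
  have ext: "b_ext m (b \<circ> inv \<sigma>) i = b_ext m (b \<circ> inv \<tau>) i" if "i \<le> m + 1" for i
    using sorting_perm_values[OF s t, of i] that by (auto simp: b_ext_def)
  have "b_prime m (b \<circ> inv \<sigma>) i * basis_vec (mu_label m i) (l \<circ> inv \<sigma>) =
        b_prime m (b \<circ> inv \<tau>) i * basis_vec (mu_label m i) (l \<circ> inv \<tau>)" if "i \<le> m" for i
  proof -
    have "b_prime m (b \<circ> inv \<sigma>) i = b_prime m (b \<circ> inv \<tau>) i"
      using ext[of i] ext[of "i + 1"] that by (simp add: b_prime_def)
    moreover have "b_prime m (b \<circ> inv \<sigma>) i \<noteq> 0 \<Longrightarrow>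
        (l \<circ> inv \<sigma> = mu_label m i) = (l \<circ> inv \<tau> = mu_label m i)"
      using eq[OF s] eq[OF t] mu_label_comp_eq[OF s t that] by simp
    ultimately show ?thesis by (auto simp: basis_vec_def)
  qed
  then show ?thesis unfolding supervertex_sorted_def by (intro sum.cong) auto
qed

lemma is_supervertexI:
  assumes s: "sorting_perm m b \<sigma>"
  shows "is_supervertex m b (\<lambda>l. supervertex_sorted m (b \<circ> inv \<sigma>) (l \<circ> inv \<sigma>))"
proof -
  have p: "\<sigma> permutes {1..m}" using s by (simp add: sorting_perm_def)
  have "l \<circ> \<sigma> \<circ> inv \<sigma> = l" for l :: label
    using permutes_inv_o[OF p] by (simp add: comp_assoc)
  then show ?thesis unfolding is_supervertex_def vec_space_def
    using s supervertex_sorted_outside label_set_comp_iff[OF permutes_inv[OF p]] by auto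
qed

lemma is_supervertexD:
  assumes q: "is_supervertex m b q" and s: "sorting_perm m b \<sigma>"
  shows "q l = supervertex_sorted m (b \<circ> inv \<sigma>) (l \<circ> inv \<sigma>)"
proof -
  obtain \<tau> where t: "sorting_perm m b \<tau>"
    and eq: "\<And>l. l \<in> label_set m \<Longrightarrow> q (l \<circ> \<tau>) = supervertex_sorted m (b \<circ> inv \<tau>) l"
    using q by (auto simp: is_supervertex_def)
  have p: "\<tau> permutes {1..m}" using t by (simp add: sorting_perm_def)
  have inv: "l \<circ> inv \<tau> \<circ> \<tau> = l" using permutes_inv_o[OF p] by (simp add: comp_assoc)
  have "q l = supervertex_sorted m (b \<circ> inv \<tau>) (l \<circ> inv \<tau>)"
  proof (cases "l \<in> label_set m")
    case True
    then have "l \<circ> inv \<tau> \<in> label_set m" using label_set_comp_iff[OF permutes_inv[OF p]] by blast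
    from eq[OF this] show ?thesis using inv by simp
  next
    case False
    then have "l \<circ> inv \<tau> \<notin> label_set m" using label_set_comp_iff[OF permutes_inv[OF p]] by blast
    then show ?thesis
      using False q supervertex_sorted_outside by (simp add: is_supervertex_def vec_space_def)
  qed
  then show ?thesis using supervertex_sorted_indep[OF s t] by simp
qed

lemma ex1_supervertex: "\<exists>!q. is_supervertex m b q"
proof -
  obtain \<sigma> where s: "sorting_perm m b \<sigma>" using sorting_perm_exists by blast
  show ?thesis
  proof (intro ex_ex1I)
    show "\<exists>q. is_supervertex m b q" using is_supervertexI[OF s] by blast
    fix q r assume "is_supervertex m b q" "is_supervertex m b r"
    then show "q = r" by (intro ext) (simp only: is_supervertexD[OF _ s])
  qed
qed

lemma supervertex_comp:
  assumes "sorting_perm m b \<sigma>"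
  shows "supervertex m b (l \<circ> \<sigma>) = supervertex_sorted m (b \<circ> inv \<sigma>) l"
proof -
  have p: "\<sigma> permutes {1..m}" using assms by (simp add: sorting_perm_def)
  have "is_supervertex m b (supervertex m b)"
    unfolding supervertex_def by (rule theI'[OF ex1_supervertex])
  from is_supervertexD[OF this assms, of "l \<circ> \<sigma>"] show ?thesis
    using permutes_inv_o[OF p] by (simp add: comp_assoc)
qed

lemma supervertex_of_sorted:
  assumes "antimono_on {1..m} b"
  shows "supervertex m b = supervertex_sorted m b"
proof -
  have "sorting_perm m b id" using assms by (simp add: sorting_perm_def permutes_id)
  from supervertex_comp[OF this] show ?thesis by (intro ext) simp
qed

end

(*
  Identify a label l with the set of its zeros. Every element u of the cone is then a nonnegative,
  increasing, supermodular set function, because the truncation is convex and increasing and the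
  coefficients a_i are positive. On the polytope the expectation of an affine function of the
  indicators of l(k) = 0 depends only on b. So u is bounded from above by the greedy affine
  function along the chain of supports of the supervertex, and from below by the affine function
  that agrees with u on the empty set and on singletons; each bound is attained where the affine
  function agrees with u on the support of the vertex.
*)
theory Submission
  imports Defs "HOL-Analysis.Function_Topology"
begin

section \<open>Labels as sets of zeros\<close>

definition zero_label :: "nat \<Rightarrow> nat set \<Rightarrow> label" where
  "zero_label m S = (\<lambda>k. if k \<in> {1..m} - S then 1 else 0)"

definition zeros :: "nat \<Rightarrow> label \<Rightarrow> nat set" where
  "zeros m l = {k\<in>{1..m}. l k = 0}"

lemma zero_label_in [simp]: "zero_label m S \<in> label_set m"
  by (auto simp: zero_label_def label_set_def)

lemma zeros_subset: "zeros m l \<subseteq> {1..m}"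
  by (auto simp: zeros_def)

lemma zero_label_zeros:
  assumes "l \<in> label_set m"
  shows "zero_label m (zeros m l) = l"
proof
  fix k
  have "k \<in> {1..m} \<Longrightarrow> l k \<in> {0, 1}" "k \<notin> {1..m} \<Longrightarrow> l k = 0"
    using assms unfolding label_set_def by blast+
  then show "zero_label m (zeros m l) k = l k"
    by (auto simp: zero_label_def zeros_def)
qed

lemma finite_label_set [simp]: "finite (label_set m)"
proof -
  have "label_set m \<subseteq> zero_label m ` Pow {1..m}"
    using zero_label_zeros zeros_subset by (metis PowI image_eqI subsetI)
  then show ?thesis by (rule finite_subset) simp
qed

lemma nu_label_eq: "nu_label m i = zero_label m {i}"
  by (auto simp: nu_label_def zero_label_def fun_eq_iff)

text \<open>Index 0 lies outside {1..m}, so the label with zero set {0} has no zeros there. The term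
  i = 0 of the subvertex thus stands for the empty set.\<close>

lemma zero_label_0: "zero_label m {0} = zero_label m {}"
  by (auto simp: zero_label_def fun_eq_iff)

text \<open>Carries the supports of the sorted supervertex over to general \<open>b\<close>: their
  zero sets become the initial segments of the order given by \<open>p\<close>.\<close>

lemma mu_label_comp:
  assumes "p permutes {1..m}"
  shows "mu_label m j \<circ> p = zero_label m {k\<in>{1..m}. p k \<le> j}"
proof
  fix k
  show "(mu_label m j \<circ> p) k = zero_label m {k\<in>{1..m}. p k \<le> j} k"
    using permutes_in_image[OF assms, of k] by (auto simp: mu_label_def zero_label_def)
qed

lemma ell_zero_label: "ell m i (zero_label m S) = (if i \<in> {1..m} - S then - 1 else 1)"
  unfolding ell_def by (simp only: zero_label_in if_True) (simp add: zero_label_def)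

lemma ell_zeros:
  assumes "l \<in> label_set m" "i \<in> {1..m}"
  shows "ell m i l = 2 * of_bool (i \<in> zeros m l) - 1"
  using ell_zero_label[of m i "zeros m l"] assms by (simp add: zero_label_zeros)

section \<open>Combinations of basis vectors and membership in the polytope\<close>

lemma iprod_basis_sum:
  assumes "\<And>i. i \<in> I \<Longrightarrow> p i \<in> label_set m"
  shows "iprod m f (\<lambda>l. \<Sum>i\<in>I. w i * basis_vec (p i) l) = (\<Sum>i\<in>I. w i * f (p i))"
proof -
  have "iprod m f (\<lambda>l. \<Sum>i\<in>I. w i * basis_vec (p i) l) =
      (\<Sum>i\<in>I. \<Sum>l\<in>label_set m. f l * (w i * basis_vec (p i) l))"
    unfolding iprod_def sum_distrib_left by (rule sum.swap)
  also have "\<dots> = (\<Sum>i\<in>I. w i * f (p i))"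
  proof (rule sum.cong[OF refl])
    fix i assume "i \<in> I"
    have "(\<Sum>l\<in>label_set m. f l * (w i * basis_vec (p i) l)) =
        (\<Sum>l\<in>label_set m. if l = p i then f (p i) * w i else 0)"
      by (rule sum.cong) (auto simp: basis_vec_def)
    then show "(\<Sum>l\<in>label_set m. f l * (w i * basis_vec (p i) l)) = w i * f (p i)"
      using assms[OF \<open>i \<in> I\<close>] by (simp add: sum.delta)
  qed
  finally show ?thesis .
qed

lemma polytope_P_basis_sum:
  assumes "\<And>j. j \<in> J \<Longrightarrow> p j \<in> label_set m" "\<And>j. j \<in> J \<Longrightarrow> 0 \<le> w j"
    and "(\<Sum>j\<in>J. w j) = 1"
    and "\<And>i. i \<in> {1..m} \<Longrightarrow> (\<Sum>j\<in>J. w j * ell m i (p j)) = b i"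
  shows "(\<lambda>l. \<Sum>j\<in>J. w j * basis_vec (p j) l) \<in> polytope_P m b"
proof -
  have "ell m 0 (p j) = 1" if "j \<in> J" for j
    using assms(1)[OF that] by (auto simp: ell_def label_set_def)
  then have "(\<Sum>j\<in>J. w j * ell m 0 (p j)) = 1" using assms(3) by simp
  moreover have "(\<lambda>l. \<Sum>j\<in>J. w j * basis_vec (p j) l) \<in> vec_space m"
    using assms(1) by (auto simp: vec_space_def basis_vec_def intro!: sum.neutral)
  moreover have "0 \<le> (\<Sum>j\<in>J. w j * basis_vec (p j) l)" for l
    using assms(2) by (auto simp: basis_vec_def intro!: sum_nonneg)
  ultimately show ?thesis
    using assms(1,4) by (simp add: polytope_P_def iprod_basis_sum)
qed

section \<open>Expectations over the polytope\<close>

lemma iprod_mono: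
  assumes "x \<in> polytope_P m b" "\<And>l. l \<in> label_set m \<Longrightarrow> f l \<le> g l"
  shows "iprod m f x \<le> iprod m g x"
  unfolding iprod_def using assms
  by (intro sum_mono mult_right_mono) (auto simp: polytope_P_def)

text \<open>The constraints fix the total mass and, for each k, the probability (1 + b k) / 2 of
  l(k) = 0. By linearity the expectation involves nothing else.\<close>

lemma iprod_affine:
  assumes x: "x \<in> polytope_P m b"
  shows "iprod m (\<lambda>l. \<alpha> + (\<Sum>k\<in>zeros m l. \<beta> k)) x = \<alpha> + (\<Sum>k\<in>{1..m}. \<beta> k * ((1 + b k) / 2))"
proof -
  have mass: "(\<Sum>l\<in>label_set m. x l) = 1"
  proof -
    have "iprod m (ell m 0) x = (\<Sum>l\<in>label_set m. x l)"
      unfolding iprod_def by (rule sum.cong) (auto simp: ell_def label_set_def)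
    then show ?thesis using x by (simp add: polytope_P_def)
  qed
  have marginal: "(\<Sum>l\<in>label_set m. of_bool (k \<in> zeros m l) * x l) = (1 + b k) / 2"
    if "k \<in> {1..m}" for k
  proof -
    have "b k = iprod m (ell m k) x" using x that by (simp add: polytope_P_def)
    also have "\<dots> = (\<Sum>l\<in>label_set m. 2 * (of_bool (k \<in> zeros m l) * x l) - x l)"
      unfolding iprod_def by (rule sum.cong) (auto simp: ell_zeros[OF _ that])
    also have "\<dots> = 2 * (\<Sum>l\<in>label_set m. of_bool (k \<in> zeros m l) * x l) - 1"
      unfolding sum_subtractf sum_distrib_left mass ..
    finally show ?thesis by simp
  qed
  have sum_zeros: "(\<Sum>k\<in>zeros m l. \<beta> k) = (\<Sum>k\<in>{1..m}. \<beta> k * of_bool (k \<in> zeros m l))" for l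
    using zeros_subset by (intro sum.mono_neutral_cong_left) auto
  have "iprod m (\<lambda>l. \<alpha> + (\<Sum>k\<in>zeros m l. \<beta> k)) x =
      \<alpha> * (\<Sum>l\<in>label_set m. x l) +
      (\<Sum>l\<in>label_set m. \<Sum>k\<in>{1..m}. \<beta> k * (of_bool (k \<in> zeros m l) * x l))"
    unfolding iprod_def sum_zeros
    by (simp only: distrib_right sum.distrib sum_distrib_left sum_distrib_right mult.assoc)
  also have "(\<Sum>l\<in>label_set m. \<Sum>k\<in>{1..m}. \<beta> k * (of_bool (k \<in> zeros m l) * x l)) =
      (\<Sum>k\<in>{1..m}. \<beta> k * (\<Sum>l\<in>label_set m. of_bool (k \<in> zeros m l) * x l))"
    unfolding sum_distrib_left by (rule sum.swap)
  also have "\<dots> = (\<Sum>k\<in>{1..m}. \<beta> k * ((1 + b k) / 2))"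
    by (rule sum.cong) (simp_all only: marginal)
  finally show ?thesis using mass by simp
qed

section \<open>Supermodular set functions, by one-element increments\<close>

definition increasing_differences :: "'a set \<Rightarrow> ('a set \<Rightarrow> real) \<Rightarrow> bool" where
  "increasing_differences M F \<longleftrightarrow>
     (\<forall>A B i. A \<subseteq> B \<longrightarrow> B \<subseteq> M \<longrightarrow> i \<in> M - B \<longrightarrow> F (insert i A) - F A \<le> F (insert i B) - F B)"

lemma increasing_differencesD:
  assumes "increasing_differences M F" "A \<subseteq> B" "B \<subseteq> M" "i \<in> M" "i \<notin> B"
  shows "F (insert i A) - F A \<le> F (insert i B) - F B"
  using assms unfolding increasing_differences_def by blast

text \<open>Build S one element at a time: each increment is at least the increment of the same
  element over the empty set.\<close>

lemma singleton_sum_le: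
  assumes F: "increasing_differences M F" and "finite S" "S \<subseteq> M"
  shows "F {} + (\<Sum>k\<in>S. F {k} - F {}) \<le> F S"
  using assms(2,3)
proof (induction S rule: finite_induct)
  case (insert i S)
  then have "F {i} - F {} \<le> F (insert i S) - F S"
    using increasing_differencesD[OF F, of "{}" S i] by simp
  then show ?case using insert by simp
qed simp

text \<open>Add the elements of S in the order of \<open>p\<close>. When k is added, the part of S
  already present is contained in the set of all predecessors of k, so the increment is at most the
  greedy one.\<close>

lemma greedy_sum_le:
  fixes m :: nat
  assumes F: "increasing_differences {1..m} F" and p: "p permutes {1..m}" and S: "S \<subseteq> {1..m}"
  shows "F S \<le> F {} + (\<Sum>k\<in>S. F {i\<in>{1..m}. p i \<le> p k} - F {i\<in>{1..m}. p i < p k})"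
proof -
  define d where "d k = F {i\<in>{1..m}. p i \<le> p k} - F {i\<in>{1..m}. p i < p k}" for k
  \<comment> \<open>Induction on the rank bound j: ranks start at 1, so j = 0 gives the empty set,
    and j = m gives all of S. Each step adds at most one element, since \<open>p\<close> is
    injective.\<close>
  have "F {k\<in>S. p k \<le> j} \<le> F {} + (\<Sum>k\<in>{k\<in>S. p k \<le> j}. d k)" for j
  proof (induction j)
    case 0
    have "1 \<le> p k" if "k \<in> S" for k using permutes_in_image[OF p, of k] S that by auto
    then have "{k\<in>S. p k \<le> 0} = {}" by fastforce
    then show ?case by (simp only:) simp
  next
    case (Suc j)
    show ?case
    proof (cases "\<exists>k\<in>S. p k = Suc j")
      case False
      then have "{k\<in>S. p k \<le> Suc j} = {k\<in>S. p k \<le> j}" by (auto simp: le_Suc_eq)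
      then show ?thesis using Suc by simp
    next
      case True
      then obtain k where k: "k \<in> S" "p k = Suc j" by blast
      have p_eq: "p i = Suc j \<longleftrightarrow> i = k" for i
        using inj_eq[OF permutes_inj[OF p], of i k] k(2) by simp
      let ?A = "{i\<in>S. p i \<le> j}" and ?B = "{i\<in>{1..m}. p i < p k}"
      have S_eq: "{i\<in>S. p i \<le> Suc j} = insert k ?A"
        unfolding le_Suc_eq p_eq using k(1) by blast
      have M_eq: "{i\<in>{1..m}. p i \<le> p k} = insert k ?B"
        unfolding k(2) le_less[of _ "Suc j"] p_eq using k(1) S by blast
      have "F (insert k ?A) - F ?A \<le> F (insert k ?B) - F ?B"
        using k S by (intro increasing_differencesD[OF F]) auto
      then have "F (insert k ?A) - F ?A \<le> d k" unfolding d_def M_eq .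
      moreover have "finite ?A" using S by (auto intro: finite_subset)
      ultimately show ?thesis using Suc k unfolding S_eq by simp
    qed
  qed
  from this[of m] have "F {k\<in>S. p k \<le> m} \<le> F {} + (\<Sum>k\<in>{k\<in>S. p k \<le> m}. d k)" .
  moreover have "p k \<le> m" if "k \<in> S" for k using permutes_in_image[OF p, of k] S that by auto
  then have "{k\<in>S. p k \<le> m} = S" by blast
  ultimately show ?thesis by (simp add: d_def)
qed

text \<open>On initial segments each element is added exactly to the set of all its predecessors, so
  the greedy sum telescopes. Hence the bound of \<open>greedy_sum_le\<close> is tight there.\<close>

lemma greedy_sum_chain:
  fixes F :: "nat set \<Rightarrow> real" and m :: nat
  assumes p: "p permutes {1..m}" and "j \<le> m"
  shows "F {i\<in>{1..m}. p i \<le> j} = F {} +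
    (\<Sum>k\<in>{k\<in>{1..m}. p k \<le> j}. F {i\<in>{1..m}. p i \<le> p k} - F {i\<in>{1..m}. p i < p k})"
  using \<open>j \<le> m\<close>
proof (induction j)
  case 0
  have "1 \<le> p k" if "k \<in> {1..m}" for k using permutes_in_image[OF p, of k] that by auto
  then have "{k\<in>{1..m}. p k \<le> 0} = {}" by fastforce
  then show ?case by (simp only:) simp
next
  case (Suc j)
  define k where "k = inv p (Suc j)"
  have pk: "p k = Suc j" unfolding k_def by (rule permutes_inverses(1)[OF p])
  have km: "k \<in> {1..m}" using permutes_in_image[OF p, of k] pk Suc.prems by simp
  have p_eq: "p i = Suc j \<longleftrightarrow> i = k" for i
    using inj_eq[OF permutes_inj[OF p], of i k] pk by simp
  have eq: "{i\<in>{1..m}. p i \<le> Suc j} = insert k {i\<in>{1..m}. p i \<le> j}"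
    unfolding le_Suc_eq p_eq using km by blast
  have "k \<notin> {i\<in>{1..m}. p i \<le> j}" using pk by simp
  moreover have "{i\<in>{1..m}. p i < p k} = {i\<in>{1..m}. p i \<le> j}" using pk by auto
  moreover have "{i\<in>{1..m}. p i \<le> p k} = insert k {i\<in>{1..m}. p i \<le> j}"
    unfolding pk by (rule eq)
  ultimately show ?case using Suc unfolding eq by simp
qed

section \<open>Elements of the cone as set functions\<close>

lemma U_lpos_insert:
  assumes "v \<in> U_lpos m"
  obtains c where "\<And>i. i \<in> {1..m} \<Longrightarrow> 0 < c i"
    "\<And>A i. i \<in> {1..m} - A \<Longrightarrow> v (zero_label m (insert i A)) = v (zero_label m A) + c i"
    "\<And>A B. A \<subseteq> B \<Longrightarrow> v (zero_label m A) \<le> v (zero_label m B)"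
proof -
  obtain a where v: "v = (\<lambda>l. \<Sum>i\<in>{0..m}. a i * ell m i l)" and a: "\<forall>i\<in>{1..m}. 0 < a i"
    using assms unfolding U_lpos_def by blast
  show thesis
  \<comment> \<open>Making i a zero turns \<open>ell m i\<close> from -1 to 1, hence the increment 2
    * a i.\<close>
  proof (rule that[of "\<lambda>i. 2 * a i"])
    show "0 < 2 * a i" if "i \<in> {1..m}" for i using a that by simp
    show "v (zero_label m (insert i A)) = v (zero_label m A) + 2 * a i"
      if "i \<in> {1..m} - A" for A i
    proof -
      have "v (zero_label m (insert i A)) - v (zero_label m A) =
          (\<Sum>k\<in>{0..m}. if k = i then 2 * a i else 0)"
        unfolding v sum_subtractf[symmetric]
        by (rule sum.cong) (use that in \<open>auto simp: ell_zero_label\<close>)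
      also have "\<dots> = 2 * a i" using that by (simp add: sum.delta)
      finally show ?thesis by simp
    qed
    show "v (zero_label m A) \<le> v (zero_label m B)" if "A \<subseteq> B" for A B
      unfolding v by (rule sum_mono) (use that a in \<open>auto simp: ell_zero_label less_imp_le\<close>)
  qed
qed

lemma U_lpos_plus_set_function:
  assumes "u \<in> U_lpos_plus m"
  shows "increasing_differences {1..m} (\<lambda>S. u (zero_label m S))"
    and "\<And>A B. A \<subseteq> B \<Longrightarrow> u (zero_label m A) \<le> u (zero_label m B)"
    and "\<And>S. 0 \<le> u (zero_label m S)"
proof -
  obtain k :: nat and v
    where u: "u = (\<lambda>l. \<Sum>j\<in>{1..k}. trunc_vec (v j) l)" and v: "\<forall>j\<in>{1..k}. v j \<in> U_lpos m"
    using assms unfolding U_lpos_plus_def by blast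
  show "increasing_differences {1..m} (\<lambda>S. u (zero_label m S))"
    unfolding increasing_differences_def u sum_subtractf[symmetric]
  proof (intro allI impI sum_mono)
    fix A B i j assume AB: "A \<subseteq> B" and i: "i \<in> {1..m} - B" and "j \<in> {1..k}"
    then have "v j \<in> U_lpos m" using v by blast
    then show "trunc_vec (v j) (zero_label m (insert i A)) - trunc_vec (v j) (zero_label m A)
        \<le> trunc_vec (v j) (zero_label m (insert i B)) - trunc_vec (v j) (zero_label m B)"
    proof (rule U_lpos_insert)
      fix c
      assume c: "\<And>i. i \<in> {1..m} \<Longrightarrow> 0 < c i"
        "\<And>A i. i \<in> {1..m} - A \<Longrightarrow> v j (zero_label m (insert i A)) = v j (zero_label m A) + c i"
        "\<And>A B. A \<subseteq> B \<Longrightarrow> v j (zero_label m A) \<le> v j (zero_label m B)"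
      have "i \<in> {1..m} - A" using AB i by blast
      \<comment> \<open>\<open>v j\<close> has the same positive increment c i at A and at B, and
        starts at B from a value at least as large. A fixed positive step changes max t 0 by at
        least as much when t is larger.\<close>
      then show ?thesis
        using c(1)[of i] c(2)[of i A] c(2)[OF i] c(3)[OF AB] i
        by (auto simp: trunc_vec_def max_def)
    qed
  qed
  show "u (zero_label m A) \<le> u (zero_label m B)" if "A \<subseteq> B" for A B
    unfolding u
  proof (rule sum_mono)
    fix j assume "j \<in> {1..k}"
    then have "v j \<in> U_lpos m" using v by blast
    then have "v j (zero_label m A) \<le> v j (zero_label m B)"
      by (rule U_lpos_insert) (use that in blast)
    then show "trunc_vec (v j) (zero_label m A) \<le> trunc_vec (v j) (zero_label m B)"
      by (auto simp: trunc_vec_def)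
  qed
  show "0 \<le> u (zero_label m S)" for S
    unfolding u trunc_vec_def by (intro sum_nonneg) simp
qed

section \<open>The supervertex and the upper bound\<close>

lemma supervertex_eq:
  assumes s: "sorting_perm m b \<sigma>"
  shows "supervertex m b = (\<lambda>l. \<Sum>j\<in>{0..m}. b_prime m (b \<circ> inv \<sigma>) j *
    basis_vec (zero_label m {k\<in>{1..m}. \<sigma> k \<le> j}) l)"
proof
  fix l :: label
  have p: "\<sigma> permutes {1..m}" using s by (simp add: sorting_perm_def)
  have inv: "l \<circ> inv \<sigma> \<circ> \<sigma> = l" "\<And>f :: label. f \<circ> \<sigma> \<circ> inv \<sigma> = f"
    using permutes_inv_o[OF p] by (simp_all add: comp_assoc)
  have "basis_vec (mu_label m j) (l \<circ> inv \<sigma>) = basis_vec (mu_label m j \<circ> \<sigma>) l" for j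
    unfolding basis_vec_def using inv by metis
  then show "supervertex m b l = (\<Sum>j\<in>{0..m}. b_prime m (b \<circ> inv \<sigma>) j *
      basis_vec (zero_label m {k\<in>{1..m}. \<sigma> k \<le> j}) l)"
    using supervertex_comp[OF s, of "l \<circ> inv \<sigma>"] inv(1)
    by (simp add: supervertex_sorted_def mu_label_comp[OF p])
qed

text \<open>The terms with j < s telescope to -(f 0 - f s) / 2, the others to (f s - f (Suc m)) / 2.
  For f = \<open>b_ext\<close> the end values 1 and -1 cancel; then s = 0 gives the total weight 1,
  and s = \<open>\<sigma> i\<close> gives the constraint for i.\<close>

lemma sum_signed_telescope:
  fixes f :: "nat \<Rightarrow> real"
  assumes "s \<le> Suc m"
  shows "(\<Sum>j\<in>{0..m}. (f j - f (j + 1)) / 2 * (if s \<le> j then 1 else - 1)) =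
    f s - (f 0 + f (Suc m)) / 2"
  using assms
proof (induction m)
  case 0
  then show ?case by (cases s) (auto simp: field_simps)
next
  case (Suc m)
  show ?case
  proof (cases "s \<le> Suc m")
    case True
    then show ?thesis using Suc.IH by (simp add: field_simps)
  next
    \<comment> \<open>No index reaches s, so every sign is negative and the induction hypothesis
      does not apply; the sum telescopes directly.\<close>
    case False
    then have s: "s = Suc (Suc m)" using Suc.prems by simp
    have "(\<Sum>j\<in>{0..Suc m}. (f j - f (j + 1)) / 2 * (if s \<le> j then 1 else - 1)) =
        (\<Sum>j\<in>{0..<Suc (Suc m)}. (f (Suc j) - f j) / 2)"
      using s by (intro sum.cong) (auto simp: field_simps)
    also have "\<dots> = (f s - f 0) / 2"
      using sum_Suc_diff'[of 0 s f] s by (simp add: sum_divide_distrib[symmetric])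
    finally show ?thesis using s by (simp add: field_simps)
  qed
qed

lemma supervertex_in_polytope_P:
  assumes b: "\<forall>i\<in>{1..m}. b i \<in> {-1..1}" and "1 \<le> m"
  shows "supervertex m b \<in> polytope_P m b"
proof -
  obtain \<sigma> where s: "sorting_perm m b \<sigma>" using sorting_perm_exists by blast
  have p: "\<sigma> permutes {1..m}" and anti: "antimono_on {1..m} (b \<circ> inv \<sigma>)"
    using s by (auto simp: sorting_perm_def)
  let ?\<beta> = "b_ext m (b \<circ> inv \<sigma>)"
  have bound: "(b \<circ> inv \<sigma>) j \<in> {-1..1}" if "j \<in> {1..m}" for j
    using permutes_in_image[OF permutes_inv[OF p]] that b by (simp add: comp_def)
  show ?thesis unfolding supervertex_eq[OF s]
  proof (rule polytope_P_basis_sum)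
    show "0 \<le> b_prime m (b \<circ> inv \<sigma>) j" if j: "j \<in> {0..m}" for j
    proof -
      \<comment> \<open>The extended sequence decreases at both ends because \<open>b\<close> takes
        values in [-1,1], and in between because \<open>\<sigma>\<close> sorts it. As 1 \<le> m, the
        successor of index 0 is an entry of \<open>b\<close>, not the appended -1.\<close>
      consider "j = 0" | "j = m" "j \<noteq> 0" | "j \<in> {1..m}" "j + 1 \<in> {1..m}"
        using j by (cases "j = 0"; cases "j = m") auto
      then have "?\<beta> (j + 1) \<le> ?\<beta> j"
      proof cases
        case 1
        then show ?thesis using bound[of 1] \<open>1 \<le> m\<close> by (simp add: b_ext_def)
      next
        case 2
        then show ?thesis using bound[of m] by (simp add: b_ext_def)
      next
        case 3
        then show ?thesis using monotone_onD[OF anti 3] by (simp add: b_ext_def)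
      qed
      then show ?thesis by (simp add: b_prime_def)
    qed
    show "(\<Sum>j\<in>{0..m}. b_prime m (b \<circ> inv \<sigma>) j) = 1"
      using sum_signed_telescope[of 0 m ?\<beta>] by (simp add: b_prime_def b_ext_def)
    fix i assume i: "i \<in> {1..m}"
    then have si: "\<sigma> i \<in> {1..m}" using permutes_in_image[OF p] by blast
    have "(\<Sum>j\<in>{0..m}. b_prime m (b \<circ> inv \<sigma>) j * ell m i (zero_label m {k\<in>{1..m}. \<sigma> k \<le> j})) =
        (\<Sum>j\<in>{0..m}. (?\<beta> j - ?\<beta> (j + 1)) / 2 * (if \<sigma> i \<le> j then 1 else - 1))"
      by (rule sum.cong) (use i in \<open>auto simp: b_prime_def ell_zero_label\<close>)
    also have "\<dots> = ?\<beta> (\<sigma> i)"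
      using sum_signed_telescope[of "\<sigma> i" m ?\<beta>] si by (simp add: b_ext_def)
    also have "\<dots> = b i" using si permutes_inverses(2)[OF p] by (auto simp: b_ext_def)
    finally show "(\<Sum>j\<in>{0..m}. b_prime m (b \<circ> inv \<sigma>) j *
        ell m i (zero_label m {k\<in>{1..m}. \<sigma> k \<le> j})) = b i" .
  qed simp
qed

lemma iprod_le_supervertex:
  assumes F: "increasing_differences {1..m} (\<lambda>S. u (zero_label m S))"
    and q: "supervertex m b \<in> polytope_P m b" and x: "x \<in> polytope_P m b"
  shows "iprod m u x \<le> iprod m u (supervertex m b)"
proof -
  obtain \<sigma> where s: "sorting_perm m b \<sigma>" using sorting_perm_exists by blast
  have p: "\<sigma> permutes {1..m}" using s by (simp add: sorting_perm_def)
  define F where "F S = u (zero_label m S)" for S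
  define d where "d k = F {i\<in>{1..m}. \<sigma> i \<le> \<sigma> k} - F {i\<in>{1..m}. \<sigma> i < \<sigma> k}" for k
  \<comment> \<open>The greedy affine function for the order \<open>\<sigma>\<close>, in which the
    zero sets of the supports of the supervertex grow.\<close>
  define L where "L l = F {} + (\<Sum>k\<in>zeros m l. d k)" for l
  have "u l \<le> L l" if "l \<in> label_set m" for l
    using greedy_sum_le[OF F p zeros_subset[of m l]] that
    by (simp add: L_def d_def F_def zero_label_zeros)
  then have "iprod m u x \<le> iprod m L x" by (rule iprod_mono[OF x])
  also have "\<dots> = iprod m L (supervertex m b)"
    using iprod_affine[OF x] iprod_affine[OF q] by (simp add: L_def[abs_def])
  also have "\<dots> = iprod m u (supervertex m b)"
  proof -
    have "L (zero_label m {k\<in>{1..m}. \<sigma> k \<le> j}) = u (zero_label m {k\<in>{1..m}. \<sigma> k \<le> j})"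
      if "j \<le> m" for j
    proof -
      have "zeros m (zero_label m {k\<in>{1..m}. \<sigma> k \<le> j}) = {k\<in>{1..m}. \<sigma> k \<le> j}"
        by (auto simp: zeros_def zero_label_def)
      then show ?thesis using greedy_sum_chain[OF p that, of F] by (simp add: L_def d_def F_def)
    qed
    then show ?thesis unfolding supervertex_eq[OF s] by (simp add: iprod_basis_sum)
  qed
  finally show ?thesis .
qed

section \<open>The subvertex and the lower bound\<close>

lemma iprod_subvertex:
  "iprod m u (subvertex m b) = u (zero_label m {}) +
     (\<Sum>k\<in>{1..m}. (u (zero_label m {k}) - u (zero_label m {})) * ((1 + b k) / 2))"
proof -
  have "iprod m u (subvertex m b) = (\<Sum>i\<in>{0..m}. b_dprime m b i * u (zero_label m {i}))"
    unfolding subvertex_def nu_label_eq by (rule iprod_basis_sum) simp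
  also have "\<dots> = b_dprime m b 0 * u (zero_label m {}) +
      (\<Sum>i\<in>{1..m}. b_dprime m b i * u (zero_label m {i}))"
    by (simp add: sum.atLeast_Suc_atMost zero_label_0)
  also have "(\<Sum>i\<in>{1..m}. b_dprime m b i * u (zero_label m {i})) =
      (\<Sum>i\<in>{1..m}. (b i + 1) / 2 * u (zero_label m {i}))"
    by (rule sum.cong) (auto simp: b_dprime_def)
  \<comment> \<open>The weight at the empty set is 1 minus the other weights; expanding it turns the
    values at singletons into differences from the value at the empty set.\<close>
  finally show ?thesis
    by (simp add: b_dprime_def left_diff_distrib sum_subtractf sum_distrib_left algebra_simps)
qed

text \<open>The formula of \<open>iprod_subvertex\<close> is what \<open>iprod_affine\<close> yields
  at every point of the polytope. The pairing with the subvertex is therefore an expectation at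
  \<open>x\<close>, even if the subvertex has a negative weight and lies outside the
  polytope.\<close>

lemma iprod_subvertex_le:
  assumes F: "increasing_differences {1..m} (\<lambda>S. u (zero_label m S))"
    and x: "x \<in> polytope_P m b"
  shows "iprod m u (subvertex m b) \<le> iprod m u x"
proof -
  define L where "L l = u (zero_label m {}) +
    (\<Sum>k\<in>zeros m l. u (zero_label m {k}) - u (zero_label m {}))" for l
  have "iprod m u (subvertex m b) = iprod m L x"
    unfolding L_def iprod_affine[OF x] by (rule iprod_subvertex)
  also have "L l \<le> u l" if "l \<in> label_set m" for l
    using singleton_sum_le[OF F finite_subset[OF zeros_subset] zeros_subset, of l] that
    by (simp add: L_def zero_label_zeros)
  then have "iprod m L x \<le> iprod m u x" by (rule iprod_mono[OF x])
  finally show ?thesis .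
qed

lemma subvertex_in_polytope_P:
  assumes b: "\<forall>i\<in>{1..m}. b i \<in> {-1..1}" and le: "(\<Sum>i\<in>{1..m}. b i) \<le> 2 - real m"
  shows "subvertex m b \<in> polytope_P m b"
proof -
  have sum: "(\<Sum>i\<in>{1..m}. (b i + 1) / 2) = ((\<Sum>i\<in>{1..m}. b i) + real m) / 2"
    by (simp add: sum_divide_distrib[symmetric] sum.distrib)
  have split: "(\<Sum>j\<in>{0..m}. b_dprime m b j * g j) =
      b_dprime m b 0 * g 0 + (\<Sum>j\<in>{1..m}. (b j + 1) / 2 * g j)" for g
  proof -
    have "(\<Sum>j\<in>{1..m}. b_dprime m b j * g j) = (\<Sum>j\<in>{1..m}. (b j + 1) / 2 * g j)"
      by (rule sum.cong) (auto simp: b_dprime_def)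
    then show ?thesis by (simp add: sum.atLeast_Suc_atMost)
  qed
  show ?thesis unfolding subvertex_def nu_label_eq
  proof (rule polytope_P_basis_sum)
    show "0 \<le> b_dprime m b j" if "j \<in> {0..m}" for j
    proof (cases "j = 0")
      case True
      \<comment> \<open>The bound 2 - m says exactly that the weights at the singletons add up to at
        most 1.\<close>
      then show ?thesis unfolding b_dprime_def sum using le by simp
    next
      case False
      then have "b j \<in> {-1..1}" using b that by simp
      then show ?thesis using False by (simp add: b_dprime_def)
    qed
    show "(\<Sum>j\<in>{0..m}. b_dprime m b j) = 1"
      using split[of "\<lambda>_. 1"] by (simp add: b_dprime_def)
    fix i assume i: "i \<in> {1..m}"
    \<comment> \<open>At the zero set {j}, \<open>ell m i\<close> is 1 if j = i and -1 otherwise.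
      The sum left over is cancelled by the weight at the empty set, where \<open>ell m i\<close> is
      -1.\<close>
    have "(\<Sum>j\<in>{1..m}. (b j + 1) / 2 * ell m i (zero_label m {j})) =
        (\<Sum>j\<in>{1..m}. (if j = i then b i + 1 else 0) - (b j + 1) / 2)"
      by (rule sum.cong) (use i in \<open>auto simp: ell_zero_label field_simps\<close>)
    also have "\<dots> = b i + 1 - (\<Sum>j\<in>{1..m}. (b j + 1) / 2)"
      using i by (simp add: sum_subtractf)
    finally have "(\<Sum>j\<in>{1..m}. (b j + 1) / 2 * ell m i (zero_label m {j})) =
        b i + 1 - (\<Sum>j\<in>{1..m}. (b j + 1) / 2)" .
    moreover have "ell m i (zero_label m {0}) = - 1" using i by (simp add: ell_zero_label)
    ultimately show "(\<Sum>j\<in>{0..m}. b_dprime m b j * ell m i (zero_label m {j})) = b i"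
      unfolding split by (simp only: b_dprime_def if_True) simp
  qed simp
qed

section \<open>Compactness and the theorem\<close>

lemma continuous_on_iprod: "continuous_on UNIV (\<lambda>x. iprod m f x)"
  unfolding iprod_def
  by (intro continuous_on_sum continuous_on_mult continuous_on_const
      continuous_on_product_coordinates)

text \<open>The ambient space has a coordinate for every function of type \<open>label\<close>, so
  compactness comes from Tychonoff: coordinates at labels in \<open>label_set m\<close> lie in
  [0,1], all others are fixed at 0, and the linear constraints are closed.\<close>

lemma compact_polytope_P: "compact (polytope_P m b)"
proof -
  define K where "K l = (if l \<in> label_set m then {0..1::real} else {0})" for l
  have "x l \<le> 1" if x: "x \<in> polytope_P m b" and l: "l \<in> label_set m" for x l
  proof -
    have "x l \<le> (\<Sum>l\<in>label_set m. x l)"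
      using x l by (intro member_le_sum) (auto simp: polytope_P_def)
    also have "\<dots> = iprod m (ell m 0) x"
      unfolding iprod_def by (rule sum.cong) (auto simp: ell_def label_set_def)
    also have "\<dots> = 1" using x by (simp add: polytope_P_def)
    finally show ?thesis .
  qed
  then have P_K: "x \<in> (\<Pi>\<^sub>E l\<in>UNIV. K l)" if "x \<in> polytope_P m b" for x
    using that by (auto simp: K_def PiE_UNIV_domain polytope_P_def vec_space_def)
  have K_P: "x \<in> vec_space m \<and> (\<forall>l\<in>label_set m. 0 \<le> x l)" if "x \<in> (\<Pi>\<^sub>E l\<in>UNIV. K l)" for x
  proof -
    have "(l \<in> label_set m \<longrightarrow> 0 \<le> x l) \<and> (l \<notin> label_set m \<longrightarrow> x l = 0)" for l
      using PiE_mem[OF that UNIV_I, of l] by (simp add: K_def split: if_splits)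
    then show ?thesis by (simp add: vec_space_def)
  qed
  have "polytope_P m b = (\<Pi>\<^sub>E l\<in>UNIV. K l) \<inter>
      ({x. iprod m (ell m 0) x = 1} \<inter> (\<Inter>i\<in>{1..m}. {x. iprod m (ell m i) x = b i}))"
    (is "_ = ?R")
  proof (rule set_eqI)
    fix x show "x \<in> polytope_P m b \<longleftrightarrow> x \<in> ?R"
      using P_K[of x] K_P[of x] unfolding polytope_P_def by blast
  qed
  moreover have "compact (\<Pi>\<^sub>E l\<in>UNIV. K l)"
  proof -
    have "compactin (product_topology (\<lambda>_. euclidean) UNIV) (\<Pi>\<^sub>E l\<in>UNIV. K l)"
      unfolding compactin_PiE by (auto simp: K_def)
    then show ?thesis by (simp add: euclidean_product_topology)
  qed
  moreover have "closed {x. iprod m f x = c}" for f c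
    by (intro closed_Collect_eq continuous_on_iprod continuous_on_const)
  then have "closed ({x. iprod m (ell m 0) x = 1} \<inter> (\<Inter>i\<in>{1..m}. {x. iprod m (ell m i) x = b i}))"
    by (intro closed_Int closed_INT ballI)
  ultimately show ?thesis by (simp only: compact_Int_closed)
qed

theorem theorem1p9:
  fixes m :: nat and b :: "nat \<Rightarrow> real" and u :: "label \<Rightarrow> real"
  assumes "1 \<le> m"
    and "\<forall>i\<in>{1..m}. b i \<in> {-1..1}"
    and "u \<in> U_lpos_plus m"
  shows "0 \<le> iprod m u (subvertex m b) \<and>
    supervertex m b \<in> polytope_P m b \<and>
    is_maximum {expect m x u | x. x \<in> polytope_P m b} (expect m (supervertex m b) u) \<and>
    expect m (supervertex m b) u = iprod m u (supervertex m b) \<and>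
    (\<exists>\<mu>. is_minimum {expect m x u | x. x \<in> polytope_P m b} \<mu> \<and>
         \<mu> \<ge> iprod m u (subvertex m b) \<and>
         ((\<Sum>i\<in>{1..m}. b i) \<le> 2 - real m \<longrightarrow>
            subvertex m b \<in> polytope_P m b \<and>
            \<mu> = iprod m u (subvertex m b) \<and>
            iprod m u (subvertex m b) = expect m (subvertex m b) u))"
proof -
  let ?P = "polytope_P m b"
  let ?s = "iprod m u (subvertex m b)"
  note u = U_lpos_plus_set_function[OF assms(3)]
  have super: "supervertex m b \<in> ?P"
    by (rule supervertex_in_polytope_P[OF assms(2,1)])
  have "0 \<le> ?s"
  proof -
    \<comment> \<open>The weight at the empty set may be negative, so the sign is read off from
      \<open>iprod_subvertex\<close>: \<open>u\<close> is increasing and b k \<ge> -1.\<close>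
    have "0 \<le> (u (zero_label m {k}) - u (zero_label m {})) * ((1 + b k) / 2)"
      if "k \<in> {1..m}" for k
      using u(2)[of "{}" "{k}"] assms(2) that by (intro mult_nonneg_nonneg) force+
    then show ?thesis
      unfolding iprod_subvertex by (intro add_nonneg_nonneg sum_nonneg u(3)) auto
  qed
  moreover have "is_maximum {expect m x u | x. x \<in> ?P} (expect m (supervertex m b) u)"
    using super iprod_le_supervertex[OF u(1) super] by (auto simp: is_maximum_def expect_def)
  \<comment> \<open>The minimum is attained: the polytope is compact, and nonempty because it
    contains the supervertex.\<close>
  moreover obtain x where x: "x \<in> ?P" "\<And>y. y \<in> ?P \<Longrightarrow> iprod m u x \<le> iprod m u y"
    using continuous_attains_inf[OF compact_polytope_P,
        where f = "iprod m u", OF _ continuous_on_subset[OF continuous_on_iprod]] super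
    by blast
  then have "is_minimum {expect m x u | x. x \<in> ?P} (iprod m u x)"
    by (auto simp: is_minimum_def expect_def)
  moreover have "?s \<le> iprod m u x" by (rule iprod_subvertex_le[OF u(1) x(1)])
  \<comment> \<open>Once the subvertex is itself a point of the polytope, minimality of
    \<open>x\<close> gives the inequality opposite to the general bound.\<close>
  moreover have "subvertex m b \<in> ?P \<and> iprod m u x = ?s"
    if "(\<Sum>i\<in>{1..m}. b i) \<le> 2 - real m"
    using subvertex_in_polytope_P[OF assms(2) that] x(2) iprod_subvertex_le[OF u(1) x(1)]
    by (auto intro: antisym)
  ultimately show ?thesis
    using super unfolding expect_def by blast
qed

end
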